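(* For a polyhedral normed space $X$, the following are equivalent: (a) $S_X$ is covered by algebraic true faces of $B_X$; (b) $w^*\text{-}\exp(B_{X^*})$ is a boundary for $X$; (c) there exists a boundary $\mathcal B$ for $X$ that is minimal with respect to inclusion (i.e. no proper subset of $\mathcal B$ is a boundary for $X$). Moreover, in case (c) holds, the boundary $\mathcal B$ coincides with $w^*\text{-}\exp(B_{X^*})$.
   Context: All normed spaces are real. For a normed space $X$, $B_X$ and $S_X$ denote its closed unit ball and unit sphere, and $X^*$ its topological dual. Polyhedral (= (K)-polyhedral): the unit ball of every finite-dimensional subspace of $X$ is a polytope, i.e. a closed, bounded convex set with finitely many extreme points. A set $\mathcal B\subseteq B_{X^*}$ is a boundary for $X$ if for every $x\in S_X$ there exists $f\in\mathcal B$ with $f(x)=1$. $w^*\text{-}\exp(B_{X^*})$ is the set of $w^*$-exposed points of $B_{X^*}$: those $f\in B_{X^*}$ for which there exists $x\in X$ with $g(x)<f(x)$ for all $g\in B_{X^*}$, $g\neq f$. Algebraic true face of $B_X$: a set $F=B_X\cap H$, where $H$ is a supporting hyperplane for $B_X$ (that is, $H=f^{-1}(1)$ with $f\in S_{X^*}$ and $H\cap B_X\neq\emptyset$), whose algebraic interior relative to $H$ is non-empty; here $p\in F$ is in the algebraic interior of $F$ relative to $H$ if for every $q\in H$ there is $\delta>0$ with $p+t(q-p)\in F$ for all $|t|\le\delta$. "Covered" means that every point of $S_X$ lies in some such face. *)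

theory Defs
  imports "HOL-Analysis.Analysis"
begin

(* A normed space X is a type 'a :: real_normed_vector (completeness is not assumed); its dual
   is the type of bounded linear functionals with the operator norm, so that B_{X*} is
   cball 0 1 there. *)

type_synonym 'a dual = "'a \<Rightarrow>\<^sub>L real"

(* The library constant polytope means "convex hull of a finite set"; here a polytope is a
   closed, bounded, convex set with finitely many extreme points. *)
definition is_polytope :: "'a::real_normed_vector set \<Rightarrow> bool" where
  "is_polytope S \<longleftrightarrow> closed S \<and> bounded S \<and> convex S \<and> finite {x. x extreme_point_of S}"

definition polyhedral_space :: "'a::real_normed_vector itself \<Rightarrow> bool" where
  "polyhedral_space (_ :: 'a itself) \<longleftrightarrow>
     (\<forall>Y :: 'a set. subspace Y \<and> (\<exists>b. finite b \<and> Y = span b) \<longrightarrow> is_polytope (cball 0 1 \<inter> Y))"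

definition is_boundary :: "'a::real_normed_vector dual set \<Rightarrow> bool" where
  "is_boundary B \<longleftrightarrow> B \<subseteq> cball 0 1 \<and> (\<forall>x \<in> sphere 0 1. \<exists>f \<in> B. blinfun_apply f x = 1)"

definition minimal_boundary :: "'a::real_normed_vector dual set \<Rightarrow> bool" where
  "minimal_boundary B \<longleftrightarrow> is_boundary B \<and> (\<forall>C. C \<subset> B \<longrightarrow> \<not> is_boundary C)"

(* If X = {0}, the only functional 0 is vacuously w*-exposed, whereas the empty set is already a
   boundary; so a minimal boundary equals wstar_exp (cball 0 1) only when X is non-trivial. *)
definition wstar_exp :: "'a::real_normed_vector dual set \<Rightarrow> 'a dual set" where
  "wstar_exp K =
     {f \<in> K. \<exists>x. \<forall>g \<in> K. g \<noteq> f \<longrightarrow> blinfun_apply g x < blinfun_apply f x}"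

definition supporting_hyperplane_ball :: "'a::real_normed_vector set \<Rightarrow> bool" where
  "supporting_hyperplane_ball H \<longleftrightarrow>
     (\<exists>f :: 'a dual. f \<in> sphere 0 1 \<and> H = {x. blinfun_apply f x = 1}) \<and> H \<inter> cball 0 1 \<noteq> {}"

definition rel_algebraic_interior :: "'a::real_vector set \<Rightarrow> 'a set \<Rightarrow> 'a set" where
  "rel_algebraic_interior H F =
     {p \<in> F. \<forall>q \<in> H. \<exists>\<delta>>0. \<forall>t. \<bar>t\<bar> \<le> \<delta> \<longrightarrow> p + t *\<^sub>R (q - p) \<in> F}"

definition algebraic_true_face :: "'a::real_normed_vector set \<Rightarrow> bool" where
  "algebraic_true_face F \<longleftrightarrow>
     (\<exists>H. supporting_hyperplane_ball H \<and> F = cball 0 1 \<inter> H \<and> rel_algebraic_interior H F \<noteq> {})"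

definition sphere_covered_by_true_faces :: "'a::real_normed_vector itself \<Rightarrow> bool" where
  "sphere_covered_by_true_faces (_ :: 'a itself) \<longleftrightarrow>
     (\<forall>x \<in> sphere (0::'a) 1. \<exists>F. algebraic_true_face F \<and> x \<in> F)"

end

theory Submission
  imports Defs
begin

text \<open>
  In a non-trivial space the \<open>w\<^sup>*\<close>-exposed functionals of the dual ball are exactly the functionals that norm, alone in the
  whole dual ball, some point of the sphere (\<open>wstar_exp_dual_ball_iff\<close>). Hence every boundary
  contains all of them, and once they form a boundary that boundary is minimal.

  Conversely, let \<open>B\<close> be a minimal boundary and \<open>f \<in> B\<close>. Removing \<open>f\<close> destroys the boundary property,
  so \<open>f\<close> is the only member of \<open>B\<close> that attains the value 1 at a certain \<open>x\<close> in the sphere. In a general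
  space other functionals of the dual ball may still norm \<open>x\<close>. Polyhedrality excludes this, since
  it makes the norm locally linear along rays: for each direction \<open>v\<close> some functional of the dual
  ball agrees with the norm on a short segment from \<open>x\<close> to \<open>x + T v\<close>
  (\<open>short_segment_in_face_cone\<close>). A functional of \<open>B\<close> that norms the midpoint of such a segment must
  then norm the segment back to its endpoint \<open>x\<close> (\<open>functional_norming_midpoint_norms_segment\<close>); so it
  is \<open>f\<close>. Therefore the norm equals \<open>f\<close> near \<open>x\<close> on every ray that starts at \<open>x\<close>. Any
  \<open>g\<close> in the dual ball with \<open>g x = 1\<close> lies below the norm, so \<open>g v \<le> f v\<close> for every \<open>v\<close>, and \<open>g = f\<close>.

  The same coincidence of the norm with \<open>f\<close> near \<open>x\<close>, applied with the whole dual ball as the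
  boundary, shows that a point exposing \<open>f\<close> lies in the algebraic interior of the face cut out by \<open>f\<close>.
  In the other direction, a functional of the dual ball that attains the value 1 at an algebraically
  interior point of a face equals 1 on the whole supporting hyperplane, which determines it; so
  functionals of true faces are \<open>w\<^sup>*\<close>-exposed.

  The local linearity along rays is proved in the plane spanned by \<open>x\<close> and \<open>v\<close>. There the ball is the
  convex hull of finitely many points, so infinitely many points of a sequence decreasing to \<open>x\<close>
  along the ray lie in the cone over one and the same face. Norming functionals are provided by the
  Hahn-Banach theorem.
\<close>

section \<open>Sublinear functionals and norming functionals\<close>

definition sublinear :: "('a::real_vector \<Rightarrow> real) \<Rightarrow> bool" where
  "sublinear p \<longleftrightarrow> (\<forall>x y. p (x + y) \<le> p x + p y) \<and> (\<forall>c x. 0 \<le> c \<longrightarrow> p (c *\<^sub>R x) = c * p x)"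

lemma sublinearD:
  assumes "sublinear p"
  shows "p (x + y) \<le> p x + p y" and "0 \<le> c \<Longrightarrow> p (c *\<^sub>R x) = c * p x"
    and "p 0 = 0" and "- p (- x) \<le> p x"
proof -
  show add: "p (x + y) \<le> p x + p y" for x y using assms by (simp add: sublinear_def)
  show scale: "0 \<le> c \<Longrightarrow> p (c *\<^sub>R x) = c * p x" for c x using assms by (simp add: sublinear_def)
  show zero: "p 0 = 0" using scale[of 0 0] by simp
  show "- p (- x) \<le> p x" using add[of x "- x"] zero by simp
qed

text \<open>
  For a positive factor \<open>c\<close> the reverse inequality follows by applying the given one to \<open>1 / c\<close>.
\<close>
lemma sublinearI:
  assumes "\<And>x y. p (x + y) \<le> p x + p y" and "p 0 = 0"
    and "\<And>c x. 0 < c \<Longrightarrow> p (c *\<^sub>R x) \<le> c * p x"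
  shows "sublinear p"
proof -
  have "p (c *\<^sub>R x) = c * p x" if "0 \<le> c" for c x
  proof (cases "c = 0")
    case True
    then show ?thesis using assms(2) by simp
  next
    case False
    with that have c: "c > 0" by simp
    have "c * p x \<le> p (c *\<^sub>R x)"
      using assms(3)[of "inverse c" "c *\<^sub>R x"] c by (simp add: field_simps)
    then show ?thesis using assms(3)[OF c, of x] by simp
  qed
  then show ?thesis using assms(1) by (auto simp: sublinear_def)
qed

text \<open>
  Zorn's lemma applies because a chain of sublinear functionals below \<open>p\<close> has a pointwise infimum:
  each member is bounded below at \<open>x\<close> by \<open>- p (- x)\<close>, and the infimum stays subadditive because one of
  any two members of the chain lies below the other.
\<close>
lemma minimal_sublinear_exists:
  fixes p :: "'a::real_vector \<Rightarrow> real"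
  assumes p: "sublinear p"
  obtains q where "sublinear q" "q \<le> p" "\<And>r. sublinear r \<Longrightarrow> r \<le> q \<Longrightarrow> r = q"
proof -
  let ?A = "{q. sublinear q \<and> q \<le> p}"
  have po: "partial_order_on ?A (relation_of (\<lambda>a b. b \<le> a) ?A)"
    by (auto simp: partial_order_on_def preorder_on_def refl_on_def trans_def antisym_def relation_of_def)
  have "\<exists>u\<in>?A. \<forall>a\<in>C. u \<le> a" if "C \<in> Chains (relation_of (\<lambda>a b. b \<le> a) ?A)" for C
  proof (cases "C = {}")
    case True
    then show ?thesis using p by auto
  next
    case ne: False
    have CA: "C \<subseteq> ?A" and tot: "\<And>c d. c \<in> C \<Longrightarrow> d \<in> C \<Longrightarrow> c \<le> d \<or> d \<le> c"
      using that by (auto simp: Chains_def relation_of_def)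
    define q where "q = (\<lambda>x. INF c\<in>C. c x)"
    have "- p (- x) \<le> c x" if "c \<in> C" for c x
      using sublinearD(4)[of c x] CA that by (force simp: le_fun_def intro: order_trans[rotated])
    then have bdd: "bdd_below ((\<lambda>c. c x) ` C)" for x
      by (intro bdd_belowI2)
    have low: "q x \<le> c x" if "c \<in> C" for c x
      unfolding q_def by (rule cINF_lower[OF bdd that])
    have great: "m \<le> q x" if "\<And>c. c \<in> C \<Longrightarrow> m \<le> c x" for m x
      unfolding q_def by (rule cINF_greatest[OF ne that])
    have "sublinear q"
    proof (rule sublinearI)
      fix x y
      have *: "q (x + y) \<le> c x + d y" if "c \<in> C" "d \<in> C" for c d
      proof -
        obtain e where e: "e \<in> C" "e \<le> c" "e \<le> d"
          using tot[OF \<open>c \<in> C\<close> \<open>d \<in> C\<close>] \<open>c \<in> C\<close> \<open>d \<in> C\<close> by blast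
        have "q (x + y) \<le> e (x + y)" by (rule low[OF e(1)])
        also have "\<dots> \<le> e x + e y" using e CA by (auto intro: sublinearD)
        also have "\<dots> \<le> c x + d y" using e by (auto simp: le_fun_def intro: add_mono)
        finally show ?thesis .
      qed
      have "q (x + y) - d y \<le> q x" if "d \<in> C" for d
        by (rule great) (use *[OF _ that] in \<open>simp add: algebra_simps\<close>)
      then have "q (x + y) - q x \<le> d y" if "d \<in> C" for d
        using that by (simp add: algebra_simps)
      then have "q (x + y) - q x \<le> q y" by (rule great)
      then show "q (x + y) \<le> q x + q y" by simp
    next
      show "q 0 = 0"
      proof (rule antisym)
        show "q 0 \<le> 0" using ne low[of _ 0] CA sublinearD(3) by fastforce
        show "0 \<le> q 0" by (rule great) (use CA sublinearD(3) in fastforce)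
      qed
    next
      fix k :: real and x assume k: "0 < k"
      have "q (k *\<^sub>R x) / k \<le> q x"
      proof (rule great)
        fix c assume c: "c \<in> C"
        have "c (k *\<^sub>R x) = k * c x" using c CA k by (auto intro!: sublinearD)
        then show "q (k *\<^sub>R x) / k \<le> c x" using low[OF c, of "k *\<^sub>R x"] k by (simp add: field_simps)
      qed
      then show "q (k *\<^sub>R x) \<le> k * q x" using k by (simp add: field_simps)
    qed
    moreover have "q \<le> p"
    proof -
      obtain c where c: "c \<in> C" using ne by blast
      then have "c \<le> p" using CA by blast
      with low[OF c] show ?thesis by (auto simp: le_fun_def intro: order_trans)
    qed
    ultimately show ?thesis using low by (auto simp: le_fun_def)
  qed
  from predicate_Zorn[OF po this] obtain m where
    m: "m \<in> ?A" "\<forall>a\<in>?A. a \<le> m \<longrightarrow> a = m" by auto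
  show ?thesis
  proof (rule that[of m])
    show "r = m" if "sublinear r" "r \<le> m" for r
      using m that by (auto intro: order_trans)
  qed (use m in auto)
qed

text \<open>
  The functional \<open>q y = inf {p (y + t v) - t p(v) | t \<ge> 0}\<close> lies below \<open>p\<close> and is odd on the line through \<open>v\<close>.
  It is what makes a minimal sublinear functional linear: a minimal one must coincide with its own \<open>q\<close>,
  for each \<open>v\<close>.
\<close>
lemma sublinear_slope_at_infinity:
  fixes p :: "'a::real_vector \<Rightarrow> real"
  assumes p: "sublinear p"
  obtains q where "sublinear q" "q \<le> p" "q (- v) \<le> - p v"
proof -
  define q where "q = (\<lambda>y. INF t\<in>{0..}. p (y + t *\<^sub>R v) - t * p v)"
  have "- p (- y) \<le> p (y + t *\<^sub>R v) - t * p v" if "0 \<le> t" for y t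
    using sublinearD(1)[OF p, of "y + t *\<^sub>R v" "- y"] sublinearD(2)[OF p that, of v] by simp
  then have bdd: "bdd_below ((\<lambda>t. p (y + t *\<^sub>R v) - t * p v) ` {0..})" for y
    by (intro bdd_belowI2) auto
  have low: "q y \<le> p (y + t *\<^sub>R v) - t * p v" if "0 \<le> t" for y t
    unfolding q_def by (rule cINF_lower[OF bdd]) (use that in simp)
  have great: "m \<le> q y" if "\<And>t. 0 \<le> t \<Longrightarrow> m \<le> p (y + t *\<^sub>R v) - t * p v" for m y
    unfolding q_def by (rule cINF_greatest) (use that in auto)
  have "sublinear q"
  proof (rule sublinearI)
    fix x y
    have *: "q (x + y) \<le> (p (x + s *\<^sub>R v) - s * p v) + (p (y + t *\<^sub>R v) - t * p v)"
      if "0 \<le> s" "0 \<le> t" for s t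
    proof -
      have "q (x + y) \<le> p ((x + s *\<^sub>R v) + (y + t *\<^sub>R v)) - (s + t) * p v"
        using low[of "s + t" "x + y"] that by (simp add: algebra_simps)
      then show ?thesis
        using sublinearD(1)[OF p, of "x + s *\<^sub>R v" "y + t *\<^sub>R v"] by (simp add: algebra_simps)
    qed
    have "q (x + y) - (p (y + t *\<^sub>R v) - t * p v) \<le> q x" if "0 \<le> t" for t
      by (rule great) (use *[OF _ that] in \<open>simp add: algebra_simps\<close>)
    then have "q (x + y) - q x \<le> p (y + t *\<^sub>R v) - t * p v" if "0 \<le> t" for t
      using that by (fastforce simp add: algebra_simps)
    then have "q (x + y) - q x \<le> q y" by (rule great)
    then show "q (x + y) \<le> q x + q y" by simp
  next
    show "q 0 = 0"
    proof (rule antisym)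
      show "q 0 \<le> 0" using low[of 0 0] sublinearD(3)[OF p] by simp
      show "0 \<le> q 0" by (rule great) (simp add: sublinearD(2)[OF p])
    qed
  next
    fix k :: real and x assume k: "0 < k"
    have "q (k *\<^sub>R x) / k \<le> q x"
    proof (rule great)
      fix t :: real assume t: "0 \<le> t"
      have "p (k *\<^sub>R (x + t *\<^sub>R v)) = k * p (x + t *\<^sub>R v)"
        using k by (auto intro!: sublinearD p)
      then show "q (k *\<^sub>R x) / k \<le> p (x + t *\<^sub>R v) - t * p v"
        using low[of "k * t" "k *\<^sub>R x"] k t by (simp add: field_simps scaleR_add_right)
    qed
    then show "q (k *\<^sub>R x) \<le> k * q x" using k by (simp add: field_simps)
  qed
  moreover have "q \<le> p" using low[of 0] by (simp add: le_fun_def)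
  moreover have "q (- v) \<le> - p v" using low[of 1 "- v"] sublinearD(3)[OF p] by simp
  ultimately show ?thesis by (rule that)
qed

text \<open>
  A minimal sublinear functional is odd, hence additive and linear. Passing below the functional of
  \<open>sublinear_slope_at_infinity\<close> before minimizing fixes the value at \<open>v\<close>.
\<close>
lemma hahn_banach_sublinear:
  fixes p :: "'a::real_vector \<Rightarrow> real"
  assumes p: "sublinear p"
  obtains g where "linear g" "\<And>x. g x \<le> p x" "g v = p v"
proof -
  have slope: "g (- w) \<le> - g w" if "sublinear g" "\<And>r. sublinear r \<Longrightarrow> r \<le> g \<Longrightarrow> r = g" for g :: "'a \<Rightarrow> real" and w
    using that by (metis sublinear_slope_at_infinity)
  obtain q where q: "sublinear q" "q \<le> p" "q (- v) \<le> - p v"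
    using sublinear_slope_at_infinity[OF p] .
  obtain g where g: "sublinear g" "g \<le> q" and min: "\<And>r. sublinear r \<Longrightarrow> r \<le> g \<Longrightarrow> r = g"
    using minimal_sublinear_exists[OF q(1)] by blast
  have neg: "g (- w) = - g w" for w
    using slope[OF g(1) min, of w] sublinearD(4)[OF g(1), of w] by simp
  have "linear g"
  proof (rule linearI)
    fix x y
    show "g (x + y) = g x + g y"
      using sublinearD(1)[OF g(1), of x y] sublinearD(1)[OF g(1), of "- x" "- y"] neg[of "x + y"] neg
      by simp
  next
    fix c :: real and x
    show "g (c *\<^sub>R x) = c *\<^sub>R g x"
      using sublinearD(2)[OF g(1), of c x] sublinearD(2)[OF g(1), of "- c" x] neg[of "c *\<^sub>R x"]
      by (cases "0 \<le> c") auto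
  qed
  moreover have le: "g x \<le> p x" for x
    using g(2) q(2) by (auto simp: le_fun_def intro: order_trans)
  moreover have "g v = p v"
    using le[of v] neg[of v] q(3) g(2) by (auto simp: le_fun_def dest: spec[of _ "- v"])
  ultimately show ?thesis by (rule that)
qed

lemma norming_functional_exists:
  fixes y :: "'a::real_normed_vector"
  obtains f :: "'a dual" where "f \<in> cball 0 1" "blinfun_apply f y = norm y"
proof -
  have "sublinear (norm :: 'a \<Rightarrow> real)"
    by (simp add: sublinear_def norm_triangle_ineq)
  then obtain g where g: "linear g" "\<And>x :: 'a. g x \<le> norm x" "g y = norm y"
    using hahn_banach_sublinear by blast
  have abs: "\<bar>g x\<bar> \<le> norm x" for x
    using g(2)[of x] g(2)[of "- x"] linear_neg[OF g(1)] by simp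
  have bl: "bounded_linear g"
    using g(1) abs by (intro bounded_linear_intro[where K = 1]) (auto simp: linear_add linear_scale)
  have "norm (Blinfun g) \<le> 1"
    by (rule norm_blinfun_bound) (simp_all add: bounded_linear_Blinfun_apply[OF bl] abs)
  then show ?thesis
    using that[of "Blinfun g"] g(3) by (simp add: bounded_linear_Blinfun_apply[OF bl])
qed

lemma dual_ball_le_norm:
  assumes "f \<in> cball (0 :: 'a::real_normed_vector dual) 1"
  shows "blinfun_apply f x \<le> norm x"
proof -
  have "norm (blinfun_apply f x) \<le> norm f * norm x" by (rule norm_blinfun)
  also have "\<dots> \<le> 1 * norm x" using assms by (intro mult_right_mono) auto
  finally show ?thesis by simp
qed

lemma is_boundary_dual_ball: "is_boundary (cball (0 :: 'a::real_normed_vector dual) 1)"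
  unfolding is_boundary_def
proof (intro conjI ballI)
  fix x :: 'a assume "x \<in> sphere 0 1"
  moreover obtain f :: "'a dual" where "f \<in> cball 0 1" "blinfun_apply f x = norm x"
    using norming_functional_exists .
  ultimately show "\<exists>f\<in>cball (0 :: 'a dual) 1. blinfun_apply f x = 1"
    by (intro bexI[of _ f]) simp_all
qed simp

section \<open>Local linearity of a polyhedral norm along rays\<close>

lemma extreme_point_of_injective_linear_image:
  assumes "linear h" "inj h" "e extreme_point_of S"
  shows "h e extreme_point_of (h ` S)"
  using assms by (auto simp: extreme_point_of_def open_segment_linear_image inj_image_mem_iff)

text \<open>
  The function \<open>z \<mapsto> norm (h z)\<close> attains a positive minimum on the Euclidean unit sphere, which bounds
  the preimage. This is the equivalence of norms in finite dimension.
\<close>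
lemma compact_ball_vimage:
  fixes h :: "'b::euclidean_space \<Rightarrow> 'a::real_normed_vector"
  assumes h: "linear h" "inj h"
  shows "compact (h -` cball 0 1)"
proof -
  have bl: "bounded_linear h" using h(1) by (simp add: linear_conv_bounded_linear)
  have cont: "continuous_on S h" for S
    using bl by (rule linear_continuous_on)
  have "continuous_on (sphere 0 1) (\<lambda>z. norm (h z))"
    by (intro continuous_on_norm cont)
  then have "\<exists>m\<in>sphere 0 1. \<forall>z\<in>sphere 0 1. norm (h m) \<le> norm (h z)"
    by (intro continuous_attains_inf) auto
  then obtain m where m: "m \<in> sphere 0 1" "\<And>z. z \<in> sphere 0 1 \<Longrightarrow> norm (h m) \<le> norm (h z)"
    by blast
  have pos: "0 < norm (h m)"
    using m(1) h linear_injective_0[OF h(1)] by auto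
  have "norm z \<le> 1 / norm (h m)" if "norm (h z) \<le> 1" for z
  proof (cases "z = 0")
    case False
    have "norm (h m) \<le> norm (h ((1 / norm z) *\<^sub>R z))" using False by (intro m) simp
    also have "\<dots> = norm (h z) / norm z" using h(1) by (simp add: linear_scale)
    also have "\<dots> \<le> 1 / norm z" using that by (intro divide_right_mono) auto
    finally show ?thesis using False pos by (simp add: field_simps)
  qed simp
  then have "bounded (h -` cball 0 1)" by (auto simp: bounded_iff intro!: exI[of _ "1 / norm (h m)"])
  moreover have "closed (h -` cball 0 1)"
    using bl by (intro continuous_closed_vimage) (auto intro: linear_continuous_at)
  ultimately show ?thesis by (simp add: compact_eq_bounded_closed)
qed

text \<open>
  By Minkowski's theorem a polytope in the sense of finitely many extreme points is the convex hull
  of a finite set. The theorem holds in Euclidean spaces, so it is applied to the preimage under the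
  parametrization \<open>h\<close> of a finite-dimensional subspace and then transported by \<open>h\<close>.
\<close>
lemma polyhedral_ball_convex_hull_finite:
  fixes h :: "'b::euclidean_space \<Rightarrow> 'a::real_normed_vector"
  assumes poly: "polyhedral_space TYPE('a)" and h: "linear h" "inj h"
  obtains E where "finite E" "cball 0 1 \<inter> range h = convex hull E"
proof -
  let ?K = "h -` cball 0 1"
  have im: "h ` ?K = cball 0 1 \<inter> range h" by auto
  have "convex ?K" by (intro convex_linear_vimage h) simp
  with compact_ball_vimage[OF h] have "?K = convex hull {e. e extreme_point_of ?K}"
    by (rule Krein_Milman_Minkowski)
  then have hull: "h ` ?K = convex hull (h ` {e. e extreme_point_of ?K})"
    by (metis convex_hull_linear_image[OF h(1)])
  have "range h = span (h ` Basis)"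
    by (simp add: span_linear_image[OF h(1)])
  then have "is_polytope (cball 0 1 \<inter> range h)"
    using poly unfolding polyhedral_space_def
    by (metis finite_Basis finite_imageI subspace_span)
  then have "finite {z. z extreme_point_of (h ` ?K)}" by (simp add: is_polytope_def im)
  moreover have "h ` {e. e extreme_point_of ?K} \<subseteq> {z. z extreme_point_of (h ` ?K)}"
    by (blast intro: extreme_point_of_injective_linear_image[OF h])
  ultimately show ?thesis using that hull im finite_subset by metis
qed

text \<open>
  The norm is convex, the functional is affine and lies below it.
\<close>
lemma functional_norming_endpoints_norms_segment:
  fixes h :: "'a::real_normed_vector dual"
  assumes h: "h \<in> cball 0 1"
    and "blinfun_apply h a = norm a" "blinfun_apply h b = norm b" and z: "z \<in> closed_segment a b"
  shows "blinfun_apply h z = norm z"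
proof (rule antisym)
  show "blinfun_apply h z \<le> norm z" by (rule dual_ball_le_norm[OF h])
  obtain u where u: "0 \<le> u" "u \<le> 1" "z = (1 - u) *\<^sub>R a + u *\<^sub>R b"
    using z by (auto simp: closed_segment_def)
  have "norm z \<le> (1 - u) * norm a + u * norm b"
    unfolding u(3) using u by (intro norm_triangle_le) simp
  also have "\<dots> = blinfun_apply h z"
    using assms by (simp add: u(3) blinfun.add_right blinfun.scaleR_right)
  finally show "norm z \<le> blinfun_apply h z" .
qed

text \<open>
  The point \<open>y\<close> is a nonnegative combination of points of the ball whose total weight is \<open>norm y\<close>. If \<open>h\<close>
  norms \<open>y\<close>, no weight can be wasted, so \<open>h\<close> equals 1 on all points used by \<open>y\<close>: these lie in one face of
  the ball. Hence \<open>h\<close> norms every point \<open>z\<close> that is represented with maximal efficiency by the same points.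
\<close>
lemma functional_norming_cone_point_norms_cone:
  fixes h :: "'a::real_normed_vector dual"
  assumes h: "h \<in> cball 0 1" and E: "finite E" "E \<subseteq> cball 0 1"
    and y: "\<And>e. e \<in> E \<Longrightarrow> 0 \<le> u e" "(\<Sum>e\<in>E. u e *\<^sub>R e) = y" "sum u E = norm y"
      "blinfun_apply h y = norm y"
    and z: "(\<Sum>e\<in>E. w e *\<^sub>R e) = z" "sum w E = norm z"
    and supp: "\<And>e. e \<in> E \<Longrightarrow> w e \<noteq> 0 \<Longrightarrow> u e \<noteq> 0"
  shows "blinfun_apply h z = norm z"
proof -
  have le1: "blinfun_apply h e \<le> 1" if "e \<in> E" for e
    using dual_ball_le_norm[OF h, of e] E that by auto
  have "(\<Sum>e\<in>E. u e * (1 - blinfun_apply h e)) = norm y - blinfun_apply h y"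
    using y(3) by (simp add: y(2)[symmetric] blinfun.sum_right blinfun.scaleR_right algebra_simps sum_subtractf)
  then have "\<forall>e\<in>E. u e * (1 - blinfun_apply h e) = 0"
    using y(1,4) le1 E(1) by (subst sum_nonneg_eq_0_iff[symmetric]) auto
  then have "w e * blinfun_apply h e = w e" if "e \<in> E" for e
    using supp that by fastforce
  then have "(\<Sum>e\<in>E. w e * blinfun_apply h e) = sum w E" by (intro sum.cong) auto
  then show ?thesis
    using z(2) by (simp add: z(1)[symmetric] blinfun.sum_right blinfun.scaleR_right)
qed

text \<open>
  This is the membership of \<open>y / norm y\<close> in the convex hull, scaled back.
\<close>
lemma norm_eq_total_weight:
  assumes E: "finite E" "cball 0 1 \<inter> Y = convex hull E" and Y: "subspace Y" and y: "y \<in> Y"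
  obtains u where "\<And>e. e \<in> E \<Longrightarrow> 0 \<le> u e" "(\<Sum>e\<in>E. u e *\<^sub>R e) = y" "sum u E = norm y"
proof (cases "y = 0")
  case True
  then show ?thesis using that[of "\<lambda>_. 0"] by simp
next
  case False
  have "(1 / norm y) *\<^sub>R y \<in> convex hull E"
    unfolding E(2)[symmetric] using Y y False by (auto intro: subspace_scale)
  then obtain u where u: "\<forall>e\<in>E. 0 \<le> u e" "sum u E = 1" "(\<Sum>e\<in>E. u e *\<^sub>R e) = (1 / norm y) *\<^sub>R y"
    unfolding convex_hull_finite[OF E(1)] by blast
  show ?thesis
  proof (rule that[of "\<lambda>e. norm y * u e"])
    have "(\<Sum>e\<in>E. (norm y * u e) *\<^sub>R e) = norm y *\<^sub>R (\<Sum>e\<in>E. u e *\<^sub>R e)"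
      by (simp add: scaleR_sum_right)
    then show "(\<Sum>e\<in>E. (norm y * u e) *\<^sub>R e) = y" using False by (simp add: u(3))
  qed (use u in \<open>auto simp: sum_distrib_left[symmetric]\<close>)
qed

text \<open>
  The points \<open>x + v / (n + 1)\<close> are represented by weights on the finite set \<open>E\<close> that generates the ball.
  There are only finitely many possible supports, so infinitely many of these points share one
  support, and a functional that norms one of them norms them all. Convexity fills the gaps between
  these points, and they accumulate at \<open>x\<close>.
\<close>
lemma short_segment_in_face_cone_independent:
  fixes x v :: "'a::real_normed_vector"
  assumes poly: "polyhedral_space TYPE('a)"
    and inj: "inj (\<lambda>(a, b). a *\<^sub>R x + b *\<^sub>R v :: 'a)"
  obtains T and h :: "'a dual" where "T > 0" "h \<in> cball 0 1"
    "\<And>s. s \<in> {0..T} \<Longrightarrow> blinfun_apply h (x + s *\<^sub>R v) = norm (x + s *\<^sub>R v)"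
proof -
  define \<phi> :: "real \<times> real \<Rightarrow> 'a" where "\<phi> = (\<lambda>(a, b). a *\<^sub>R x + b *\<^sub>R v)"
  have lin: "linear \<phi>"
    by (rule linearI) (auto simp: \<phi>_def algebra_simps)
  obtain E where E: "finite E" "cball 0 1 \<inter> range \<phi> = convex hull E"
    using polyhedral_ball_convex_hull_finite[OF poly lin] inj unfolding \<phi>_def by blast
  have E1: "E \<subseteq> cball 0 1" using hull_subset[of E convex] E(2) by blast
  define y where "y n = x + (1 / Suc n) *\<^sub>R v" for n :: nat
  have "y n = \<phi> (1, 1 / Suc n)" for n by (simp add: \<phi>_def y_def)
  then have "\<exists>u. (\<forall>e\<in>E. 0 \<le> u e) \<and> (\<Sum>e\<in>E. u e *\<^sub>R e) = y n \<and> sum u E = norm (y n)" for n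
    by (metis norm_eq_total_weight[OF E linear_subspace_image[OF lin subspace_UNIV]] rangeI)
  then obtain u where u: "\<And>n e. e \<in> E \<Longrightarrow> 0 \<le> u n e" "\<And>n. (\<Sum>e\<in>E. u n e *\<^sub>R e) = y n"
    "\<And>n. sum (u n) E = norm (y n)" by metis
  define S where "S n = {e \<in> E. u n e \<noteq> 0}" for n
  have "finite (range S)"
    by (rule finite_subset[of _ "Pow E"]) (use E(1) in \<open>auto simp: S_def\<close>)
  then obtain m where m: "infinite {n. S n = S m}"
    using pigeonhole_infinite[of "UNIV :: nat set" S] by auto
  obtain h :: "'a dual" where h: "h \<in> cball 0 1" "blinfun_apply h (y m) = norm (y m)"
    using norming_functional_exists .
  have sub: "blinfun_apply h (y n) = norm (y n)" if "S n = S m" for n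
    using functional_norming_cone_point_norms_cone[OF h(1) E(1) E1 u(1,2,3) h(2) u(2,3), of n] that
    by (auto simp: S_def)
  define T where "T = 1 / real (Suc m)"
  have T: "T > 0" by (simp add: T_def)
  have half: "blinfun_apply h (x + s *\<^sub>R v) = norm (x + s *\<^sub>R v)" if s: "s \<in> {0<..T}" for s
  proof -
    \<comment> \<open>The point at parameter s lies between two points with the support of y m.\<close>
    obtain k where k: "1 / real (Suc k) < s"
      using s by (metis greaterThanAtMost_iff nat_approx_posE)
    obtain n where n: "n > k" "S n = S m"
      using m by (metis (mono_tags, lifting) infinite_nat_iff_unbounded mem_Collect_eq)
    define r where "r = 1 / real (Suc n)"
    have "r < 1 / real (Suc k)" using n(1) by (auto simp: r_def field_simps)
    with k have r: "r < s" by simp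
    have "s \<in> closed_segment r T" using r s by (auto simp: closed_segment_eq_real_ivl)
    then obtain c where c: "0 \<le> c" "c \<le> 1" "s = (1 - c) * r + c * T"
      by (auto simp: closed_segment_def)
    have "x + s *\<^sub>R v = (1 - c) *\<^sub>R y n + c *\<^sub>R y m"
      by (simp add: c(3) y_def r_def T_def algebra_simps)
    then have "x + s *\<^sub>R v \<in> closed_segment (y n) (y m)"
      using c by (auto simp: closed_segment_def)
    then show ?thesis using functional_norming_endpoints_norms_segment[OF h(1) sub[OF n(2)] h(2)] by blast
  qed
  \<comment> \<open>The parameter 0 is reached by continuity.\<close>
  have lim: "((\<lambda>s. x + s *\<^sub>R v) \<longlongrightarrow> x) (at_right 0)"
    by (auto intro!: tendsto_eq_intros)
  have "((\<lambda>s. blinfun_apply h (x + s *\<^sub>R v) - norm (x + s *\<^sub>R v)) \<longlongrightarrow> blinfun_apply h x - norm x) (at_right 0)"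
    by (intro tendsto_intros lim)
  moreover have "\<forall>\<^sub>F s in at_right 0. blinfun_apply h (x + s *\<^sub>R v) - norm (x + s *\<^sub>R v) = 0"
    unfolding eventually_at_right_field using T half by (intro exI[of _ T]) auto
  then have "((\<lambda>s. blinfun_apply h (x + s *\<^sub>R v) - norm (x + s *\<^sub>R v)) \<longlongrightarrow> 0) (at_right 0)"
    by (rule tendsto_eventually)
  ultimately have "blinfun_apply h x - norm x = 0"
    by (rule tendsto_unique[OF trivial_limit_at_right_real])
  then have "blinfun_apply h (x + s *\<^sub>R v) = norm (x + s *\<^sub>R v)" if "s \<in> {0..T}" for s
    using half[of s] that by (cases "s = 0") auto
  with T h(1) show ?thesis by (rule that)
qed

text \<open>
  If \<open>v\<close> is a multiple of \<open>x\<close>, or \<open>x\<close> is zero, the segment stays on one ray from the origin as long as it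
  is short, and there the norm is linear.
\<close>
lemma short_segment_in_face_cone:
  fixes x v :: "'a::real_normed_vector"
  assumes poly: "polyhedral_space TYPE('a)"
  obtains T and h :: "'a dual" where "T > 0" "h \<in> cball 0 1"
    "\<And>s. s \<in> {0..T} \<Longrightarrow> blinfun_apply h (x + s *\<^sub>R v) = norm (x + s *\<^sub>R v)"
proof -
  consider "x = 0" | c where "x \<noteq> 0" "v = c *\<^sub>R x" | "x \<noteq> 0" "\<And>c. v \<noteq> c *\<^sub>R x" by blast
  then show ?thesis
  proof cases
    case 1
    obtain h :: "'a dual" where "h \<in> cball 0 1" "blinfun_apply h v = norm v"
      using norming_functional_exists .
    then show ?thesis using that[of 1 h] 1 by (simp add: blinfun.scaleR_right)
  next
    case (2 c)
    obtain h :: "'a dual" where h: "h \<in> cball 0 1" "blinfun_apply h x = norm x"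
      using norming_functional_exists .
    show ?thesis
    proof (rule that[of "1 / (\<bar>c\<bar> + 1)" h])
      fix s assume s: "s \<in> {0..1 / (\<bar>c\<bar> + 1)}"
      then have "s * \<bar>c\<bar> \<le> 1"
        by (auto simp: field_simps)
      then have "\<bar>s * c\<bar> \<le> 1" using s by (simp add: abs_mult)
      then have "0 \<le> 1 + s * c" by linarith
      moreover have "x + s *\<^sub>R v = (1 + s * c) *\<^sub>R x" by (simp add: 2 algebra_simps)
      ultimately show "blinfun_apply h (x + s *\<^sub>R v) = norm (x + s *\<^sub>R v)"
        using h(2) by (simp add: blinfun.scaleR_right)
    qed (use h in auto)
  next
    case 3
    have "inj (\<lambda>(a, b). a *\<^sub>R x + b *\<^sub>R v)"
    proof (rule injI, clarify)
      fix a b a' b' assume eq: "a *\<^sub>R x + b *\<^sub>R v = a' *\<^sub>R x + b' *\<^sub>R v"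
      then have *: "(b - b') *\<^sub>R v = (a' - a) *\<^sub>R x" by (simp add: algebra_simps)
      have "b = b'"
      proof (rule ccontr)
        assume "b \<noteq> b'"
        then have "v = ((a' - a) / (b - b')) *\<^sub>R x"
          using arg_cong[OF *, of "\<lambda>z. (1 / (b - b')) *\<^sub>R z"] by simp
        then show False using 3 by blast
      qed
      with * 3 show "a = a' \<and> b = b'" by simp
    qed
    then show ?thesis using short_segment_in_face_cone_independent[OF poly] that by metis
  qed
qed

text \<open>
  With \<open>k\<close> a functional that agrees with the norm on a segment, \<open>h\<close> lies below \<open>k\<close> at both endpoints. If \<open>h\<close>
  meets \<open>k\<close> at the midpoint, then \<open>h\<close> and \<open>k\<close> agree on the segment. Here \<open>x + T v\<close> is that
  midpoint. The point is that \<open>T\<close> does not depend on \<open>h\<close>, so that \<open>h\<close> may be chosen afterwards from a given boundary.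
\<close>
lemma functional_norming_midpoint_norms_segment:
  fixes x v :: "'a::real_normed_vector"
  assumes poly: "polyhedral_space TYPE('a)"
  obtains T where "T > 0"
    "\<And>h :: 'a dual. h \<in> cball 0 1 \<Longrightarrow> blinfun_apply h (x + T *\<^sub>R v) = norm (x + T *\<^sub>R v) \<Longrightarrow>
       \<forall>s\<in>{0..T}. blinfun_apply h (x + s *\<^sub>R v) = norm (x + s *\<^sub>R v)"
proof -
  obtain T and k :: "'a dual" where T: "T > 0" and k: "k \<in> cball 0 1"
    "\<And>s. s \<in> {0..T} \<Longrightarrow> blinfun_apply k (x + s *\<^sub>R v) = norm (x + s *\<^sub>R v)"
    using short_segment_in_face_cone[OF poly] by blast
  show ?thesis
  proof (rule that[of "T / 2"])
    fix h :: "'a dual"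
    assume h: "h \<in> cball 0 1"
      and mid: "blinfun_apply h (x + (T / 2) *\<^sub>R v) = norm (x + (T / 2) *\<^sub>R v)"
    have le: "blinfun_apply h (x + s *\<^sub>R v) \<le> blinfun_apply k (x + s *\<^sub>R v)" if "s \<in> {0..T}" for s
      using dual_ball_le_norm[OF h] k(2)[OF that] by metis
    have eq: "blinfun_apply h (x + (T / 2) *\<^sub>R v) = blinfun_apply k (x + (T / 2) *\<^sub>R v)"
      using mid k(2)[of "T / 2"] T by simp
    note expand = blinfun.add_right blinfun.scaleR_right
    have ends: "blinfun_apply h x \<le> blinfun_apply k x"
      "blinfun_apply h x + T * blinfun_apply h v \<le> blinfun_apply k x + T * blinfun_apply k v"
      "blinfun_apply h x + T * blinfun_apply h v / 2 = blinfun_apply k x + T * blinfun_apply k v / 2"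
      using le[of 0] le[of T] eq T by (simp_all add: expand)
    then have hx: "blinfun_apply h x = blinfun_apply k x" by linarith
    from ends have "T * blinfun_apply h v = T * blinfun_apply k v" by linarith
    then have "blinfun_apply h v = blinfun_apply k v" using T by simp
    then show "\<forall>s\<in>{0..T / 2}. blinfun_apply h (x + s *\<^sub>R v) = norm (x + s *\<^sub>R v)"
      using hx k(2) T by (auto simp: expand)
  qed (use T in simp)
qed

section \<open>Boundaries and exposed functionals\<close>

lemma boundary_norms:
  fixes y :: "'a::real_normed_vector"
  assumes B: "is_boundary B" "B \<noteq> {}"
  obtains h where "h \<in> B" "blinfun_apply h y = norm y"
proof (cases "y = 0")
  case True
  then show ?thesis using that B(2) by (auto simp: blinfun.zero_right)
next
  case False
  then have "(1 / norm y) *\<^sub>R y \<in> sphere 0 1" by simp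
  then obtain h where "h \<in> B" "blinfun_apply h ((1 / norm y) *\<^sub>R y) = 1"
    using B(1) unfolding is_boundary_def by blast
  then show ?thesis using that[of h] False by (simp add: blinfun.scaleR_right field_simps)
qed

text \<open>
  A member of \<open>B\<close> that norms \<open>x + T v\<close>, for a suitable small \<open>T\<close>, also norms \<open>x\<close>, so it is \<open>f\<close>.
\<close>
lemma norm_eq_unique_boundary_functional_nearby:
  fixes x v :: "'a::real_normed_vector"
  assumes poly: "polyhedral_space TYPE('a)" and B: "is_boundary B" and x: "x \<in> sphere 0 1"
    and f: "f \<in> B" and uniq: "\<And>g. g \<in> B \<Longrightarrow> blinfun_apply g x = 1 \<Longrightarrow> g = f"
  obtains T where "T > 0" "\<And>s. s \<in> {0..T} \<Longrightarrow> norm (x + s *\<^sub>R v) = blinfun_apply f (x + s *\<^sub>R v)"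
proof -
  obtain T where T: "T > 0"
    "\<And>h :: 'a dual. h \<in> cball 0 1 \<Longrightarrow> blinfun_apply h (x + T *\<^sub>R v) = norm (x + T *\<^sub>R v) \<Longrightarrow>
       \<forall>s\<in>{0..T}. blinfun_apply h (x + s *\<^sub>R v) = norm (x + s *\<^sub>R v)"
    using functional_norming_midpoint_norms_segment[OF poly] by blast
  obtain h where h: "h \<in> B" "blinfun_apply h (x + T *\<^sub>R v) = norm (x + T *\<^sub>R v)"
    using boundary_norms[OF B] f by blast
  have "h \<in> cball 0 1" using B h(1) by (auto simp: is_boundary_def)
  note hs = T(2)[OF this h(2)]
  have "blinfun_apply h x = 1" using bspec[OF hs, of 0] T(1) x by simp
  then have "h = f" by (rule uniq[OF h(1)])
  then show ?thesis using that[OF T(1)] hs by simp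
qed

text \<open>
  The norm coincides with \<open>f\<close> close to \<open>x\<close> on each ray, so a functional \<open>g\<close> below the norm that agrees
  with \<open>f\<close> at \<open>x\<close> satisfies \<open>g v \<le> f v\<close> in each direction \<open>v\<close>; using \<open>- v\<close> as well gives equality.
\<close>
lemma unique_boundary_functional_unique_in_dual_ball:
  fixes x :: "'a::real_normed_vector"
  assumes poly: "polyhedral_space TYPE('a)" and B: "is_boundary B" and x: "x \<in> sphere 0 1"
    and f: "f \<in> B" and uniq: "\<And>g. g \<in> B \<Longrightarrow> blinfun_apply g x = 1 \<Longrightarrow> g = f"
    and g: "g \<in> cball 0 1" "blinfun_apply g x = 1"
  shows "g = f"
proof -
  have le: "blinfun_apply g v \<le> blinfun_apply f v" for v
  proof -
    obtain T where T: "T > 0"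
      "\<And>s. s \<in> {0..T} \<Longrightarrow> norm (x + s *\<^sub>R v) = blinfun_apply f (x + s *\<^sub>R v)"
      using norm_eq_unique_boundary_functional_nearby[OF poly B x f uniq] by blast
    have "blinfun_apply f x = 1" using T(2)[of 0] T(1) x by simp
    moreover have "blinfun_apply g (x + T *\<^sub>R v) \<le> blinfun_apply f (x + T *\<^sub>R v)"
      using dual_ball_le_norm[OF g(1), of "x + T *\<^sub>R v"] T by simp
    ultimately show ?thesis using g(2) T(1) by (simp add: blinfun.add_right blinfun.scaleR_right)
  qed
  show ?thesis
    by (rule blinfun_eqI, rule antisym[OF le])
       (use le[of "- v" for v] in \<open>simp add: blinfun.minus_right\<close>)
qed

text \<open>
  By Hahn-Banach the maximum of the dual ball at an exposing point \<open>x\<close> is \<open>norm x\<close>. Non-triviality of the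
  space guarantees \<open>x \<noteq> 0\<close>: at 0 all functionals agree, and the dual ball has more than one element.
\<close>
lemma wstar_exp_dual_ball_iff:
  fixes f :: "'a::real_normed_vector dual"
  assumes nontriv: "\<exists>x::'a. x \<noteq> 0"
  shows "f \<in> wstar_exp (cball 0 1) \<longleftrightarrow>
    f \<in> cball 0 1 \<and> (\<exists>x\<in>sphere 0 1. blinfun_apply f x = 1 \<and>
      (\<forall>g\<in>cball 0 1. blinfun_apply g x = 1 \<longrightarrow> g = f))"
proof
  assume "f \<in> wstar_exp (cball 0 1)"
  then obtain x where f: "f \<in> cball 0 1"
    and x: "\<And>g. g \<in> cball 0 1 \<Longrightarrow> g \<noteq> f \<Longrightarrow> blinfun_apply g x < blinfun_apply f x"
    unfolding wstar_exp_def by blast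
  obtain z :: 'a where z: "z \<noteq> 0" using nontriv by blast
  obtain k :: "'a dual" where k: "k \<in> cball 0 1" "blinfun_apply k z = norm z"
    using norming_functional_exists .
  have "k \<noteq> 0" using k z by auto
  have "x \<noteq> 0"
  proof
    assume "x = 0"
    then have "g = f" if "g \<in> cball 0 1" for g using x[OF that] by (auto simp: blinfun.zero_right)
    from this[OF k(1)] this[of 0] \<open>k \<noteq> 0\<close> show False by simp
  qed
  have max: "g = f" if g: "g \<in> cball 0 1" "blinfun_apply g x = norm x" for g
    using x[OF g(1)] g(2) dual_ball_le_norm[OF f, of x] by fastforce
  have "blinfun_apply f x = norm x"
    using norming_functional_exists[of x] max by metis
  with \<open>x \<noteq> 0\<close> max have "blinfun_apply f ((1 / norm x) *\<^sub>R x) = 1 \<and>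
      (\<forall>g\<in>cball 0 1. blinfun_apply g ((1 / norm x) *\<^sub>R x) = 1 \<longrightarrow> g = f)"
    by (auto simp: blinfun.scaleR_right field_simps)
  moreover have "(1 / norm x) *\<^sub>R x \<in> sphere 0 1" using \<open>x \<noteq> 0\<close> by simp
  ultimately show "f \<in> cball 0 1 \<and> (\<exists>x\<in>sphere 0 1. blinfun_apply f x = 1 \<and>
      (\<forall>g\<in>cball 0 1. blinfun_apply g x = 1 \<longrightarrow> g = f))" using f by blast
next
  assume "f \<in> cball 0 1 \<and> (\<exists>x\<in>sphere 0 1. blinfun_apply f x = 1 \<and>
      (\<forall>g\<in>cball 0 1. blinfun_apply g x = 1 \<longrightarrow> g = f))"
  then obtain x where f: "f \<in> cball 0 1" and x: "x \<in> sphere 0 1" "blinfun_apply f x = 1"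
    "\<And>g. g \<in> cball 0 1 \<Longrightarrow> blinfun_apply g x = 1 \<Longrightarrow> g = f" by blast
  have "blinfun_apply g x < blinfun_apply f x" if "g \<in> cball 0 1" "g \<noteq> f" for g
    using dual_ball_le_norm[OF that(1), of x] x that by fastforce
  then show "f \<in> wstar_exp (cball 0 1)" using f unfolding wstar_exp_def by blast
qed

lemma wstar_exp_subset_boundary:
  fixes B :: "'a::real_normed_vector dual set"
  assumes nontriv: "\<exists>x::'a. x \<noteq> 0" and B: "is_boundary B"
  shows "wstar_exp (cball 0 1) \<subseteq> B"
proof
  fix f :: "'a dual" assume "f \<in> wstar_exp (cball 0 1)"
  then obtain x where x: "x \<in> sphere 0 1" "\<And>g. g \<in> cball 0 1 \<Longrightarrow> blinfun_apply g x = 1 \<Longrightarrow> g = f"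
    unfolding wstar_exp_dual_ball_iff[OF nontriv] by blast
  obtain g where "g \<in> B" "blinfun_apply g x = 1" using B x(1) unfolding is_boundary_def by blast
  then show "f \<in> B" using x(2)[of g] B by (auto simp: is_boundary_def)
qed

text \<open>
  Minimality gives for each \<open>f \<in> B\<close> a point at which \<open>f\<close> is the only member of \<open>B\<close> with value 1, and
  polyhedrality extends this uniqueness from \<open>B\<close> to the whole dual ball.
\<close>
lemma minimal_boundary_eq_wstar_exp:
  fixes B :: "'a::real_normed_vector dual set"
  assumes poly: "polyhedral_space TYPE('a)" and nontriv: "\<exists>x::'a. x \<noteq> 0" and B: "minimal_boundary B"
  shows "B = wstar_exp (cball 0 1)"
proof (rule antisym)
  have bd: "is_boundary B" using B by (simp add: minimal_boundary_def)
  show "wstar_exp (cball 0 1) \<subseteq> B" by (rule wstar_exp_subset_boundary[OF nontriv bd])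
  show "B \<subseteq> wstar_exp (cball 0 1)"
  proof
    fix f assume f: "f \<in> B"
    then have "\<not> is_boundary (B - {f})" using B by (auto simp: minimal_boundary_def)
    then obtain x where x: "x \<in> sphere 0 1" "\<And>g. g \<in> B \<Longrightarrow> blinfun_apply g x = 1 \<Longrightarrow> g = f"
      using bd unfolding is_boundary_def by blast
    have "blinfun_apply f x = 1" using bd x unfolding is_boundary_def by blast
    moreover have "g = f" if "g \<in> cball 0 1" "blinfun_apply g x = 1" for g
      by (rule unique_boundary_functional_unique_in_dual_ball[OF poly bd x(1) f x(2) that])
    ultimately show "f \<in> wstar_exp (cball 0 1)"
      unfolding wstar_exp_dual_ball_iff[OF nontriv]
      using x(1) f bd unfolding is_boundary_def by blast
  qed
qed

lemma minimal_boundary_wstar_exp: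
  assumes nontriv: "\<exists>x::'a::real_normed_vector. x \<noteq> 0"
    and bd: "is_boundary (wstar_exp (cball (0 :: 'a dual) 1))"
  shows "minimal_boundary (wstar_exp (cball (0 :: 'a dual) 1))"
  unfolding minimal_boundary_def
  using bd wstar_exp_subset_boundary[OF nontriv] by blast

section \<open>True faces\<close>

text \<open>
  An algebraically interior point \<open>p\<close> of the face exposes \<open>f\<close>. If \<open>g\<close> in the dual ball also has the value
  1 at \<open>p\<close>, then \<open>g\<close> is at most 1 on short segments through \<open>p\<close> in both directions along the hyperplane,
  so it is constant on them. Hence \<open>g\<close> vanishes on the kernel of \<open>f\<close>.
\<close>
lemma true_face_functional_wstar_exposed:
  fixes f :: "'a::real_normed_vector dual"
  assumes f: "f \<in> cball 0 1" and int: "rel_algebraic_interior {x. blinfun_apply f x = 1}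
      (cball 0 1 \<inter> {x. blinfun_apply f x = 1}) \<noteq> {}"
  shows "f \<in> wstar_exp (cball 0 1)"
proof -
  let ?H = "{x. blinfun_apply f x = 1}"
  obtain p where p: "p \<in> cball 0 1" "blinfun_apply f p = 1"
    "\<And>q. q \<in> ?H \<Longrightarrow> \<exists>\<delta>>0. \<forall>t. \<bar>t\<bar> \<le> \<delta> \<longrightarrow> p + t *\<^sub>R (q - p) \<in> cball 0 1 \<inter> ?H"
    using int unfolding rel_algebraic_interior_def by blast
  have "g = f" if g: "g \<in> cball 0 1" "1 \<le> blinfun_apply g p" for g
  proof (rule blinfun_eqI)
    have gp: "blinfun_apply g p = 1"
      using dual_ball_le_norm[OF g(1), of p] p(1) g(2) by auto
    fix y
    \<comment> \<open>The projection of y onto the kernel of f along p.\<close>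
    let ?w = "y - blinfun_apply f y *\<^sub>R p"
    have "p + ?w \<in> ?H" using p(2) by (simp add: blinfun.add_right blinfun.diff_right blinfun.scaleR_right)
    then obtain \<delta> where \<delta>: "\<delta> > 0" "\<And>t. \<bar>t\<bar> \<le> \<delta> \<Longrightarrow> p + t *\<^sub>R ?w \<in> cball 0 1 \<inter> ?H"
      using p(3)[of "p + ?w"] by auto
    have "1 + t * blinfun_apply g ?w \<le> 1" if "\<bar>t\<bar> \<le> \<delta>" for t
    proof -
      have "blinfun_apply g (p + t *\<^sub>R ?w) \<le> norm (p + t *\<^sub>R ?w)" by (rule dual_ball_le_norm[OF g(1)])
      also have "\<dots> \<le> 1" using \<delta>(2)[OF that] by simp
      finally show ?thesis using gp by (simp only: blinfun.add_right blinfun.scaleR_right real_scaleR_def)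
    qed
    from this[of \<delta>] this[of "- \<delta>"] \<delta>(1) have "blinfun_apply g ?w = 0"
      by (simp add: mult_le_0_iff zero_le_mult_iff)
    then show "blinfun_apply g y = blinfun_apply f y"
      using gp by (simp add: blinfun.diff_right blinfun.scaleR_right)
  qed
  then have "blinfun_apply g p < blinfun_apply f p" if "g \<in> cball 0 1" "g \<noteq> f" for g
    using that p(2) by (metis not_less)
  then show ?thesis using f unfolding wstar_exp_def by blast
qed

text \<open>
  An exposing point \<open>x\<close> of the sphere is algebraically interior: for \<open>q\<close> in the hyperplane the norm
  coincides with \<open>f\<close> on short segments from \<open>x\<close> in the directions \<open>q - x\<close> and \<open>x - q\<close>, and \<open>f\<close> equals 1 there.
\<close>
lemma wstar_exposed_functional_true_face:
  fixes f :: "'a::real_normed_vector dual"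
  assumes poly: "polyhedral_space TYPE('a)" and nontriv: "\<exists>x::'a. x \<noteq> 0"
    and "f \<in> wstar_exp (cball 0 1)"
  shows "algebraic_true_face (cball 0 1 \<inter> {x. blinfun_apply f x = 1})"
proof -
  let ?H = "{x. blinfun_apply f x = 1}"
  obtain x where f: "f \<in> cball 0 1" and x: "x \<in> sphere 0 1" "blinfun_apply f x = 1"
    "\<And>g. g \<in> cball 0 1 \<Longrightarrow> blinfun_apply g x = 1 \<Longrightarrow> g = f"
    using assms(3) unfolding wstar_exp_dual_ball_iff[OF nontriv] by blast
  have "1 \<le> norm f" using norm_blinfun[of f x] x by simp
  then have "f \<in> sphere 0 1" using f by simp
  then have "supporting_hyperplane_ball ?H"
    unfolding supporting_hyperplane_ball_def using x by auto
  moreover have "x \<in> rel_algebraic_interior ?H (cball 0 1 \<inter> ?H)"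
    unfolding rel_algebraic_interior_def
  proof (intro CollectI conjI ballI)
    show "x \<in> cball 0 1 \<inter> ?H" using x by simp
    fix q assume q: "q \<in> ?H"
    have near: "\<exists>T>0. \<forall>s\<in>{0..T}. norm (x + s *\<^sub>R v) = blinfun_apply f (x + s *\<^sub>R v)" for v
      using norm_eq_unique_boundary_functional_nearby[OF poly is_boundary_dual_ball x(1) f x(3), of v] by metis
    obtain T where T: "T > 0" "\<And>s. s \<in> {0..T} \<Longrightarrow>
        norm (x + s *\<^sub>R (q - x)) = blinfun_apply f (x + s *\<^sub>R (q - x))"
      using near by blast
    obtain T' where T': "T' > 0" "\<And>s. s \<in> {0..T'} \<Longrightarrow>
        norm (x + s *\<^sub>R - (q - x)) = blinfun_apply f (x + s *\<^sub>R - (q - x))"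
      using near by blast
    have inH: "blinfun_apply f (x + t *\<^sub>R (q - x)) = 1" for t
      using q x(2) by (simp add: blinfun.add_right blinfun.scaleR_right blinfun.diff_right)
    have "norm (x + t *\<^sub>R (q - x)) = 1" if "\<bar>t\<bar> \<le> min T T'" for t
    proof (cases "0 \<le> t")
      case True
      then show ?thesis using T(2)[of t] that inH by simp
    next
      case False
      have "(- t) *\<^sub>R - (q - x) = t *\<^sub>R (q - x)" by (simp only: scaleR_minus_left scaleR_minus_right minus_minus)
      then show ?thesis using T'(2)[of "- t"] that inH[of t] False by simp
    qed
    then show "\<exists>\<delta>>0. \<forall>t. \<bar>t\<bar> \<le> \<delta> \<longrightarrow> x + t *\<^sub>R (q - x) \<in> cball 0 1 \<inter> ?H"
      using T(1) T'(1) inH by (intro exI[of _ "min T T'"]) simp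
  qed
  ultimately show ?thesis unfolding algebraic_true_face_def by blast
qed

lemma covered_iff_wstar_exp_boundary:
  assumes poly: "polyhedral_space TYPE('a::real_normed_vector)" and nontriv: "\<exists>x::'a. x \<noteq> 0"
  shows "sphere_covered_by_true_faces TYPE('a) \<longleftrightarrow> is_boundary (wstar_exp (cball (0 :: 'a dual) 1))"
proof
  assume cov: "sphere_covered_by_true_faces TYPE('a)"
  have "\<exists>f\<in>wstar_exp (cball 0 1). blinfun_apply f x = 1" if "x \<in> sphere (0::'a) 1" for x
  proof -
    obtain F where F: "algebraic_true_face F" "x \<in> F"
      using cov \<open>x \<in> sphere 0 1\<close> unfolding sphere_covered_by_true_faces_def by blast
    then obtain f :: "'a dual" where f: "f \<in> sphere 0 1" "F = cball 0 1 \<inter> {x. blinfun_apply f x = 1}"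
      "rel_algebraic_interior {x. blinfun_apply f x = 1} F \<noteq> {}"
      unfolding algebraic_true_face_def supporting_hyperplane_ball_def by blast
    then show ?thesis using true_face_functional_wstar_exposed[of f] F(2) by auto
  qed
  then show "is_boundary (wstar_exp (cball (0 :: 'a dual) 1))"
    unfolding is_boundary_def by (auto simp: wstar_exp_def)
next
  assume bd: "is_boundary (wstar_exp (cball (0 :: 'a dual) 1))"
  show "sphere_covered_by_true_faces TYPE('a)"
    unfolding sphere_covered_by_true_faces_def
  proof
    fix x :: 'a assume x: "x \<in> sphere 0 1"
    then obtain f where f: "f \<in> wstar_exp (cball (0 :: 'a dual) 1)" "blinfun_apply f x = 1"
      using bd unfolding is_boundary_def by blast
    have "x \<in> cball 0 1 \<inter> {x. blinfun_apply f x = 1}" using x f(2) by simp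
    then show "\<exists>F. algebraic_true_face F \<and> x \<in> F"
      using wstar_exposed_functional_true_face[OF poly nontriv f(1)] by blast
  qed
qed

theorem theorem3p8:
  assumes "polyhedral_space TYPE('a::real_normed_vector)"
  shows "(sphere_covered_by_true_faces TYPE('a)
            \<longleftrightarrow> is_boundary (wstar_exp (cball (0 :: 'a dual) 1)))
       \<and> (is_boundary (wstar_exp (cball (0 :: 'a dual) 1))
            \<longleftrightarrow> (\<exists>B :: 'a dual set. minimal_boundary B))
       \<and> ((\<exists>x::'a. x \<noteq> 0) \<longrightarrow>
            (\<forall>B :: 'a dual set. minimal_boundary B \<longrightarrow> B = wstar_exp (cball 0 1)))"
proof (cases "\<exists>x::'a. x \<noteq> 0")
  case True
  have eq: "B = wstar_exp (cball 0 1)" if "minimal_boundary B" for B :: "'a dual set"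
    by (rule minimal_boundary_eq_wstar_exp[OF assms True that])
  have "is_boundary (wstar_exp (cball (0 :: 'a dual) 1)) \<longleftrightarrow> (\<exists>B :: 'a dual set. minimal_boundary B)"
    using minimal_boundary_wstar_exp[OF True] eq unfolding minimal_boundary_def by blast
  then show ?thesis using covered_iff_wstar_exp_boundary[OF assms True] eq by blast
next
  case False
  \<comment> \<open>In the zero space the sphere is empty, so every subset of the dual ball is a boundary.\<close>
  then have "sphere (0::'a) 1 = {}" by (metis ex_in_conv mem_sphere_0 norm_zero zero_neq_one)
  then have "sphere_covered_by_true_faces TYPE('a)"
    "is_boundary (wstar_exp (cball (0 :: 'a dual) 1))" "minimal_boundary ({} :: 'a dual set)"
    by (auto simp: sphere_covered_by_true_faces_def is_boundary_def minimal_boundary_def wstar_exp_def)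
  then show ?thesis using False by blast
qed

end
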